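(* Let $O'\subseteq\mathbb{R}^d$ be convex with $\rho$ the Euclidean metric, let $\varepsilon\ge 0$, and let $\mathcal{S}$ be a stateless system with output function $f:I\to O$ and judge $j=(j_I:I\to I',\,j_O:O\to O')$. Let $\{U_1,\dots,U_n\}$ be a covering with $n\ge d+1$, and fix $i'\in I'$. If $$A_\varepsilon(i',U_{\alpha_1}\cup\cdots\cup U_{\alpha_{d+1}})\ne\varnothing$$ for every $(d+1)$-element subfamily $\{U_{\alpha_1},\dots,U_{\alpha_{d+1}}\}$, then $A_\varepsilon(i',U_1\cup\cdots\cup U_n)\neq\varnothing$. The bound $d+1$ is sharp: it cannot in general be replaced by $d$, i.e. for each $d\ge 1$ there are such data (with $O'=\mathbb{R}^d$) and a covering such that $A_\varepsilon(i',\cdot)$ is non-empty for the union of every $d$-element subfamily but empty for the union of the whole covering.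
   Context: Definable sets and maps are with respect to an o-minimal structure expanding $(\mathbb{R},<,+,\cdot)$. A stateless system has exactly one before-state and one after-state, so it amounts to non-empty definable sets $I$, $O$ and a definable output function $f:I\to O$. A judge is a pair of definable maps $j_I:I\to I'$, $j_O:O\to O'$, where $(O',\rho)$ is a metric space. A covering is a finite family of patches $U_1,\dots,U_n$, where each patch is given by definable open subsets $I_{U_\alpha}\subseteq I$ and $O_{U_\alpha}\subseteq O$ with $f(I_{U_\alpha})\subseteq O_{U_\alpha}$, such that $\bigcup_\alpha I_{U_\alpha}=I$ and $\bigcup_\alpha O_{U_\alpha}=O$. A union of patches $U$ has input set $I_U$ equal to the union of the input sets of the patches. For $i'\in I'$ and a patch, or union of patches, $U$, the target set is $T(i',U):=\{j_O(f(i)) : i\in I_U,\ j_I(i)=i'\}\subseteq O'$ and the feasibility set is $A_\varepsilon(i',U):=\bigcap_{t\in T(i',U)}\bar B(t,\varepsilon)\subseteq O'$, where $\bar B(t,\varepsilon)=\{o\in O':\rho(o,t)\le\varepsilon\}$ (the empty intersection being $O'$). *)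

theory Defs
  imports "HOL-Analysis.Analysis"
begin

text \<open>
  Points of \<open>\<real>\<^sup>n\<close> are the functions \<^typ>\<open>nat \<Rightarrow> real\<close> vanishing from index \<open>n\<close> on, i.e. the
  elements of the library's \<^const>\<open>Euclidean_space\<close>, whose topology is the usual one.
  Dimensions are therefore ordinary natural numbers.
\<close>

type_synonym point = "nat \<Rightarrow> real"

abbreviation Rn :: "nat \<Rightarrow> point set" where
  "Rn n \<equiv> topspace (Euclidean_space n)"

definition join :: "nat \<Rightarrow> point \<Rightarrow> point \<Rightarrow> point" where
  "join m x y = (\<lambda>i. if i < m then x i else y (i - m))"

definition truncate :: "nat \<Rightarrow> point \<Rightarrow> point" where
  "truncate n x = (\<lambda>i. if i < n then x i else 0)"

definition euclid_dist :: "nat \<Rightarrow> point \<Rightarrow> point \<Rightarrow> real" where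
  "euclid_dist d x y = L2_set (\<lambda>i. x i - y i) {..<d}"

definition convex_set :: "point set \<Rightarrow> bool" where
  "convex_set C \<longleftrightarrow>
     (\<forall>x\<in>C. \<forall>y\<in>C. \<forall>u\<in>{0..1::real}. (\<lambda>i. (1 - u) * x i + u * y i) \<in> C)"


section \<open>O-minimal structures expanding the real field\<close>

text \<open>
  A structure is given by its definable sets: \<open>Df n\<close> is the collection of the definable subsets
  of \<open>\<real>\<^sup>n\<close> (van den Dries' axioms). Definability is with parameters; this is part of
  \<open>o_minimal\<close>, by which every singleton of \<open>\<real>\<close> is definable. The axioms \<open>prod_left\<close> and
  \<open>prod_right\<close> are about \<open>\<real> \<times> A\<close> and \<open>A \<times> \<real>\<close>. In \<open>o_minimal\<close>, intervals may be open, closed,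
  half-open, bounded, unbounded or single points.
\<close>

locale o_minimal_structure =
  fixes Df :: "nat \<Rightarrow> point set set"
  assumes subset: "\<And>n A. A \<in> Df n \<Longrightarrow> A \<subseteq> Rn n"
    and empty: "\<And>n. {} \<in> Df n"
    and union: "\<And>n A B. A \<in> Df n \<Longrightarrow> B \<in> Df n \<Longrightarrow> A \<union> B \<in> Df n"
    and compl: "\<And>n A. A \<in> Df n \<Longrightarrow> Rn n - A \<in> Df n"
    and prod_left: "\<And>n A. A \<in> Df n \<Longrightarrow> {x \<in> Rn (Suc n). (\<lambda>i. x (Suc i)) \<in> A} \<in> Df (Suc n)"
    and prod_right: "\<And>n A. A \<in> Df n \<Longrightarrow> {x \<in> Rn (Suc n). truncate n x \<in> A} \<in> Df (Suc n)"
    and diagonal: "\<And>n. {x \<in> Rn (Suc n). x 0 = x n} \<in> Df (Suc n)"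
    and projection: "\<And>n A. A \<in> Df (Suc n) \<Longrightarrow> truncate n ` A \<in> Df n"
    and less: "{x \<in> Rn 2. x 0 < x 1} \<in> Df 2"
    and add: "{x \<in> Rn 3. x 0 + x 1 = x 2} \<in> Df 3"
    and mult: "{x \<in> Rn 3. x 0 * x 1 = x 2} \<in> Df 3"
    and o_minimal: "\<And>A. A \<in> Df 1 \<longleftrightarrow>
          (\<exists>\<J>::real set set. finite \<J> \<and> (\<forall>J\<in>\<J>. is_interval J) \<and> A = {x \<in> Rn 1. x 0 \<in> \<Union>\<J>})"

definition definable_map ::
  "(nat \<Rightarrow> point set set) \<Rightarrow> nat \<Rightarrow> point set \<Rightarrow> nat \<Rightarrow> point set \<Rightarrow> (point \<Rightarrow> point) \<Rightarrow> bool" where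
  "definable_map Df m A n B f \<longleftrightarrow>
     A \<in> Df m \<and> B \<in> Df n \<and> f ` A \<subseteq> B \<and> (\<lambda>x. join m x (f x)) ` A \<in> Df (m + n)"


section \<open>Stateless systems, judges and coverings\<close>

text \<open>Maps are total HOL functions; only their values on the relevant domain matter.\<close>

record system =
  in_dim :: nat
  inputs :: "point set"
  out_dim :: nat
  outputs :: "point set"
  out_fun :: "point \<Rightarrow> point"

definition stateless_system :: "(nat \<Rightarrow> point set set) \<Rightarrow> system \<Rightarrow> bool" where
  "stateless_system Df S \<longleftrightarrow>
     inputs S \<noteq> {} \<and> outputs S \<noteq> {} \<and>
     definable_map Df (in_dim S) (inputs S) (out_dim S) (outputs S) (out_fun S)"

text \<open>The fields describe \<open>j\<^sub>I : I \<rightarrow> I'\<close>, \<open>j\<^sub>O : O \<rightarrow> O'\<close> and the metric \<open>\<rho>\<close> on \<open>O'\<close>.\<close>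

record judge =
  jin_dim :: nat
  jin_space :: "point set"
  jin_map :: "point \<Rightarrow> point"
  jout_dim :: nat
  jout_space :: "point set"
  jout_map :: "point \<Rightarrow> point"
  jout_dist :: "point \<Rightarrow> point \<Rightarrow> real"

definition judge_of :: "(nat \<Rightarrow> point set set) \<Rightarrow> system \<Rightarrow> judge \<Rightarrow> bool" where
  "judge_of Df S J \<longleftrightarrow>
     definable_map Df (in_dim S) (inputs S) (jin_dim J) (jin_space J) (jin_map J) \<and>
     definable_map Df (out_dim S) (outputs S) (jout_dim J) (jout_space J) (jout_map J) \<and>
     Metric_space (jout_space J) (jout_dist J)"

definition euclidean_judge :: "nat \<Rightarrow> judge \<Rightarrow> bool" where
  "euclidean_judge d J \<longleftrightarrow>
     jout_dim J = d \<and>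
     (\<forall>x\<in>jout_space J. \<forall>y\<in>jout_space J. jout_dist J x y = euclid_dist d x y)"

record patch =
  patch_in :: "point set"
  patch_out :: "point set"

text \<open>Openness is relative to \<open>I\<close> and \<open>O\<close>, respectively.\<close>

definition patch_of :: "(nat \<Rightarrow> point set set) \<Rightarrow> system \<Rightarrow> patch \<Rightarrow> bool" where
  "patch_of Df S U \<longleftrightarrow>
     patch_in U \<in> Df (in_dim S) \<and>
     openin (subtopology (Euclidean_space (in_dim S)) (inputs S)) (patch_in U) \<and>
     patch_out U \<in> Df (out_dim S) \<and>
     openin (subtopology (Euclidean_space (out_dim S)) (outputs S)) (patch_out U) \<and>
     out_fun S ` patch_in U \<subseteq> patch_out U"

text \<open>The family \<open>U\<^sub>1, \<dots>, U\<^sub>n\<close> is indexed by \<open>{..<n}\<close>.\<close>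

definition covering :: "(nat \<Rightarrow> point set set) \<Rightarrow> system \<Rightarrow> nat \<Rightarrow> (nat \<Rightarrow> patch) \<Rightarrow> bool" where
  "covering Df S n U \<longleftrightarrow>
     (\<forall>\<alpha><n. patch_of Df S (U \<alpha>)) \<and>
     (\<Union>\<alpha><n. patch_in (U \<alpha>)) = inputs S \<and>
     (\<Union>\<alpha><n. patch_out (U \<alpha>)) = outputs S"

definition union_in :: "(nat \<Rightarrow> patch) \<Rightarrow> nat set \<Rightarrow> point set" where
  "union_in U K = (\<Union>\<alpha>\<in>K. patch_in (U \<alpha>))"

text \<open>The argument \<open>X\<close> below is the input set of a patch or of a union of patches.\<close>

definition target_set :: "system \<Rightarrow> judge \<Rightarrow> point \<Rightarrow> point set \<Rightarrow> point set" where
  "target_set S J i' X = {jout_map J (out_fun S i) |i. i \<in> X \<and> jin_map J i = i'}"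

definition feasibility_set ::
  "system \<Rightarrow> judge \<Rightarrow> real \<Rightarrow> point \<Rightarrow> point set \<Rightarrow> point set" where
  "feasibility_set S J \<epsilon> i' X =
     jout_space J \<inter>
     (\<Inter>t\<in>target_set S J i' X. Metric_space.mcball (jout_space J) (jout_dist J) t \<epsilon>)"

end

theory Submission
  imports Defs
begin

text \<open>
  The feasibility set of a union of patches is the intersection of the feasibility sets of the
  patches, and each of these is convex, being an intersection of Euclidean balls with the convex
  set \<open>O'\<close>. The positive part is therefore Helly's theorem in dimension \<open>d\<close>. As dimensions are
  numbers here and not types, Helly's theorem is derived for \<^term>\<open>Rn d\<close> along the classical
  route: more than \<open>m\<close> vectors with \<open>m\<close> coordinates have a nontrivial linear relation
  (\<open>nontrivial_relation\<close>); applied to \<open>d + 2\<close> points with an additional coordinate \<open>1\<close>, this gives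
  two disjoint subfamilies whose convex hulls meet (\<open>Radon_partition\<close>); Helly's theorem (\<open>Helly\<close>)
  follows by induction on the number of convex sets.

  Sharpness is witnessed by the \<open>d + 1\<close> vertices of a regular simplex with centre \<open>0\<close>, taken as
  inputs, outputs and targets of the identity system, with one singleton patch per vertex. A common
  input label makes every vertex a target. With \<open>\<epsilon>\<close> the circumradius of a facet, the centre of
  a facet is feasible for its \<open>d\<close> vertices, but no point is within \<open>\<epsilon>\<close> of all vertices: the sum of
  the squared distances to the vertices is least at the centre \<open>0\<close>, where it is too large already
  (\<open>simplex_uncoverable\<close>). All sets in this example other than the whole space are finite, hence
  definable in every o-minimal structure (\<open>finite_definable\<close>).
\<close>

section \<open>Helly's theorem in \<open>\<real>\<^sup>d\<close> for a numerical dimension\<close>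

text \<open>
  Gaussian elimination: if some vector has a nonzero last coordinate, a multiple of it
  clears that coordinate in all the others, which leaves one vector and one coordinate fewer.
\<close>

lemma nontrivial_relation:
  fixes v :: "'a \<Rightarrow> nat \<Rightarrow> real"
  assumes "finite N" "card N > m"
  shows "\<exists>c. (\<exists>\<alpha>\<in>N. c \<alpha> \<noteq> 0) \<and> (\<forall>i<m. (\<Sum>\<alpha>\<in>N. c \<alpha> * v \<alpha> i) = 0)"
  using assms
proof (induction m arbitrary: N v)
  case 0
  then have "N \<noteq> {}" by auto
  then show ?case by (intro exI[of _ "\<lambda>_. 1"]) auto
next
  case (Suc m)
  show ?case
  proof (cases "\<forall>\<alpha>\<in>N. v \<alpha> m = 0")
    case True
    obtain c where c: "\<exists>\<alpha>\<in>N. c \<alpha> \<noteq> 0" "\<forall>i<m. (\<Sum>\<alpha>\<in>N. c \<alpha> * v \<alpha> i) = 0"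
      using Suc.IH[of N v] Suc.prems by auto
    then have "\<forall>i<Suc m. (\<Sum>\<alpha>\<in>N. c \<alpha> * v \<alpha> i) = 0"
      using True by (auto simp: less_Suc_eq)
    with c(1) show ?thesis by blast
  next
    case False
    then obtain \<beta> where \<beta>: "\<beta> \<in> N" "v \<beta> m \<noteq> 0" by blast
    define w where "w \<alpha> i = v \<alpha> i - v \<alpha> m / v \<beta> m * v \<beta> i" for \<alpha> i
    have "card (N - {\<beta>}) > m"
      using Suc.prems \<beta> by simp
    then obtain c where c: "\<exists>\<alpha>\<in>N-{\<beta>}. c \<alpha> \<noteq> 0" "\<forall>i<m. (\<Sum>\<alpha>\<in>N-{\<beta>}. c \<alpha> * w \<alpha> i) = 0"
      using Suc.IH[of "N - {\<beta>}" w] Suc.prems by auto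
    define c' where "c' = c(\<beta> := - (\<Sum>\<alpha>\<in>N-{\<beta>}. c \<alpha> * (v \<alpha> m / v \<beta> m)))"
    have eq: "(\<Sum>\<alpha>\<in>N. c' \<alpha> * v \<alpha> i) = (\<Sum>\<alpha>\<in>N-{\<beta>}. c \<alpha> * w \<alpha> i)" for i
    proof -
      have "(\<Sum>\<alpha>\<in>N. c' \<alpha> * v \<alpha> i) = c' \<beta> * v \<beta> i + (\<Sum>\<alpha>\<in>N-{\<beta>}. c' \<alpha> * v \<alpha> i)"
        using Suc.prems \<beta> by (simp add: sum.remove)
      also have "(\<Sum>\<alpha>\<in>N-{\<beta>}. c' \<alpha> * v \<alpha> i) = (\<Sum>\<alpha>\<in>N-{\<beta>}. c \<alpha> * v \<alpha> i)"
        by (intro sum.cong) (auto simp: c'_def)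
      also have "c' \<beta> * v \<beta> i + \<dots> = (\<Sum>\<alpha>\<in>N-{\<beta>}. c \<alpha> * w \<alpha> i)"
        by (simp add: c'_def w_def sum_distrib_right right_diff_distrib sum_subtractf mult.assoc)
      finally show ?thesis .
    qed
    have "w \<alpha> m = 0" for \<alpha>
      using \<beta> by (simp add: w_def)
    then have "\<forall>i<Suc m. (\<Sum>\<alpha>\<in>N. c' \<alpha> * v \<alpha> i) = 0"
      using c(2) by (simp add: eq less_Suc_eq)
    moreover have "\<exists>\<alpha>\<in>N. c' \<alpha> \<noteq> 0"
      using c(1) by (auto simp: c'_def)
    ultimately show ?thesis by blast
  qed
qed

text \<open>
  The two subfamilies collect the positive and the remaining coefficients of an affine relation;
  dividing by the sum of the positive ones turns both sides into convex combinations.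
\<close>

lemma Radon_partition:
  fixes x :: "'a \<Rightarrow> point"
  assumes N: "finite N" "card N \<ge> d + 2" and x: "x ` N \<subseteq> Rn d"
  shows "\<exists>P u v. P \<subseteq> N \<and> (\<forall>\<alpha>\<in>P. u \<alpha> \<ge> 0) \<and> sum u P = 1 \<and>
           (\<forall>\<alpha>\<in>N-P. v \<alpha> \<ge> 0) \<and> sum v (N - P) = 1 \<and>
           (\<lambda>i. \<Sum>\<alpha>\<in>P. u \<alpha> * x \<alpha> i) = (\<lambda>i. \<Sum>\<alpha>\<in>N-P. v \<alpha> * x \<alpha> i)"
proof -
  \<comment> \<open>The additional coordinate \<open>1\<close> makes the coefficients of the relation sum to \<open>0\<close>.\<close>
  obtain c where c: "\<exists>\<alpha>\<in>N. c \<alpha> \<noteq> 0"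
      "\<forall>i<Suc d. (\<Sum>\<alpha>\<in>N. c \<alpha> * (if i < d then x \<alpha> i else 1)) = 0"
    using nontrivial_relation[of N "Suc d" "\<lambda>\<alpha> i. if i < d then x \<alpha> i else 1"] N by auto
  have sum0: "sum c N = 0"
    using c(2)[rule_format, of d] by simp
  have rel: "(\<Sum>\<alpha>\<in>N. c \<alpha> * x \<alpha> i) = 0" for i
  proof (cases "i < d")
    case True
    then show ?thesis using c(2)[rule_format, of i] by simp
  next
    case False
    then have "\<forall>\<alpha>\<in>N. x \<alpha> i = 0"
      using x by (auto simp: topspace_Euclidean_space)
    then show ?thesis by simp
  qed
  define P where "P = {\<alpha>\<in>N. c \<alpha> > 0}"
  have P: "P \<subseteq> N" "finite P" using N by (auto simp: P_def)
  have split: "sum g N = sum g P + sum g (N - P)" for g :: "'a \<Rightarrow> real"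
    using N P by (metis add.commute sum.subset_diff)
  define s where "s = sum c P"
  have s': "sum c (N - P) = - s"
    using split[of c] sum0 by (simp add: s_def)
  have "s > 0"
  proof (rule ccontr)
    assume "\<not> s > 0"
    moreover have "P \<noteq> {} \<Longrightarrow> s > 0"
      unfolding s_def using P by (intro sum_pos) (auto simp: P_def)
    ultimately have "P = {}" by blast
    then have "\<forall>\<alpha>\<in>N. - c \<alpha> \<ge> 0" "sum (\<lambda>\<alpha>. - c \<alpha>) N = 0"
      using sum0 by (auto simp: P_def not_less sum_negf)
    then have "\<forall>\<alpha>\<in>N. - c \<alpha> = 0"
      using sum_nonneg_eq_0_iff[OF N(1), of "\<lambda>\<alpha>. - c \<alpha>"] by simp
    with c(1) show False by simp
  qed
  show ?thesis
  proof (rule exI[of _ P], rule exI[of _ "\<lambda>\<alpha>. c \<alpha> / s"], rule exI[of _ "\<lambda>\<alpha>. - c \<alpha> / s"],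
      intro conjI)
    show "(\<lambda>i. \<Sum>\<alpha>\<in>P. c \<alpha> / s * x \<alpha> i) = (\<lambda>i. \<Sum>\<alpha>\<in>N - P. - c \<alpha> / s * x \<alpha> i)"
    proof
      fix i
      have "(\<Sum>\<alpha>\<in>P. c \<alpha> * x \<alpha> i) = - (\<Sum>\<alpha>\<in>N-P. c \<alpha> * x \<alpha> i)"
        using split[of "\<lambda>\<alpha>. c \<alpha> * x \<alpha> i"] rel[of i] by linarith
      then have "(\<Sum>\<alpha>\<in>P. c \<alpha> * x \<alpha> i) / s = - (\<Sum>\<alpha>\<in>N-P. c \<alpha> * x \<alpha> i) / s" by simp
      then show "(\<Sum>\<alpha>\<in>P. c \<alpha> / s * x \<alpha> i) = (\<Sum>\<alpha>\<in>N - P. - c \<alpha> / s * x \<alpha> i)"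
        by (simp add: sum_divide_distrib sum_negf)
    qed
    show "(\<Sum>\<alpha>\<in>N - P. - c \<alpha> / s) = 1"
      using s' \<open>s > 0\<close> by (simp add: sum_negf flip: sum_divide_distrib)
    show "(\<Sum>\<alpha>\<in>P. c \<alpha> / s) = 1"
      using \<open>s > 0\<close> by (simp add: s_def flip: sum_divide_distrib)
    show "\<forall>\<alpha>\<in>P. c \<alpha> / s \<ge> 0" "\<forall>\<alpha>\<in>N - P. - c \<alpha> / s \<ge> 0"
      using \<open>s > 0\<close> by (auto simp: P_def divide_nonpos_pos not_less)
  qed (rule P)
qed

lemma convex_set_sum:
  assumes C: "convex_set C"
    and "finite A" "\<And>\<alpha>. \<alpha> \<in> A \<Longrightarrow> u \<alpha> \<ge> 0" "sum u A = 1" "\<And>\<alpha>. \<alpha> \<in> A \<Longrightarrow> x \<alpha> \<in> C"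
  shows "(\<lambda>i. \<Sum>\<alpha>\<in>A. u \<alpha> * x \<alpha> i) \<in> C"
  using assms(2-)
proof (induction A arbitrary: u)
  case empty
  then show ?case by simp
next
  case (insert \<beta> A)
  show ?case
  proof (cases "u \<beta> = 1")
    case True
    then have "sum u A = 0" using insert.prems insert.hyps by simp
    then have "\<forall>\<alpha>\<in>A. u \<alpha> = 0"
      using insert.prems(1) insert.hyps(1) by (simp add: sum_nonneg_eq_0_iff)
    then show ?thesis
      using insert.prems insert.hyps True by simp
  next
    case False
    have sumA: "sum u A = 1 - u \<beta>" using insert.prems insert.hyps by simp
    have "sum u A \<ge> 0" using insert.prems by (intro sum_nonneg) auto
    then have lt: "u \<beta> < 1" using sumA False by simp
    define y where "y = (\<lambda>i. \<Sum>\<alpha>\<in>A. u \<alpha> / (1 - u \<beta>) * x \<alpha> i)"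
    have "y \<in> C" unfolding y_def
      using insert.prems lt sumA by (intro insert.IH) (auto simp flip: sum_divide_distrib)
    then have "(\<lambda>i. (1 - u \<beta>) * y i + u \<beta> * x \<beta> i) \<in> C"
      using C insert.prems lt unfolding convex_set_def by simp
    also have "(\<lambda>i. (1 - u \<beta>) * y i + u \<beta> * x \<beta> i) = (\<lambda>i. \<Sum>\<alpha>\<in>insert \<beta> A. u \<alpha> * x \<alpha> i)"
      using insert.hyps lt by (simp add: y_def sum_distrib_left add.commute)
    finally show ?thesis .
  qed
qed

text \<open>
  The induction step omits one set at a time and takes a point \<open>x \<alpha>\<close> common to all sets but
  \<open>C \<alpha>\<close>. The Radon point of these is a convex combination of points \<open>x \<alpha>\<close> with \<open>\<alpha>\<close> in \<open>P\<close>, all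
  of which lie in each \<open>C \<beta>\<close> with \<open>\<beta>\<close> outside \<open>P\<close>, and symmetrically.
\<close>

theorem Helly:
  fixes C :: "'a \<Rightarrow> point set"
  assumes "finite N" "card N \<ge> d + 1"
    and "\<And>\<alpha>. \<alpha> \<in> N \<Longrightarrow> C \<alpha> \<subseteq> Rn d" "\<And>\<alpha>. \<alpha> \<in> N \<Longrightarrow> convex_set (C \<alpha>)"
    and "\<And>K. K \<subseteq> N \<Longrightarrow> card K = d + 1 \<Longrightarrow> (\<Inter>\<alpha>\<in>K. C \<alpha>) \<noteq> {}"
  shows "(\<Inter>\<alpha>\<in>N. C \<alpha>) \<noteq> {}"
  using assms
proof (induction "card N" arbitrary: N rule: less_induct)
  case less
  show ?case
  proof (cases "card N = d + 1")
    case True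
    then show ?thesis using less.prems(5)[of N] by simp
  next
    case False
    then have card: "card N \<ge> d + 2" using less.prems by simp
    have "(\<Inter>\<beta>\<in>N-{\<alpha>}. C \<beta>) \<noteq> {}" if "\<alpha> \<in> N" for \<alpha>
    proof (rule less.hyps)
      show "card (N - {\<alpha>}) < card N" "card (N - {\<alpha>}) \<ge> d + 1"
        using card that less.prems(1) by auto
      show "(\<Inter>\<beta>\<in>K. C \<beta>) \<noteq> {}" if "K \<subseteq> N - {\<alpha>}" "card K = d + 1" for K
        by (rule less.prems(5)) (use that in auto)
    qed (use less.prems in auto)
    then have "\<forall>\<alpha>\<in>N. \<exists>y. \<forall>\<beta>\<in>N-{\<alpha>}. y \<in> C \<beta>"
      by (simp add: ex_in_conv[symmetric] del: ex_in_conv)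
    then obtain x where x: "\<And>\<alpha> \<beta>. \<alpha> \<in> N \<Longrightarrow> \<beta> \<in> N - {\<alpha>} \<Longrightarrow> x \<alpha> \<in> C \<beta>"
      by (metis bchoice)
    have "x \<alpha> \<in> Rn d" if "\<alpha> \<in> N" for \<alpha>
    proof -
      have "card (N - {\<alpha>}) > 0" using card that less.prems(1) by simp
      then have "N - {\<alpha>} \<noteq> {}" by (metis card_gt_0_iff)
      then show ?thesis using x[OF that] less.prems(3) by blast
    qed
    then have "x ` N \<subseteq> Rn d" by blast
    from Radon_partition[OF less.prems(1) card this]
    obtain P u v where P: "P \<subseteq> N" and u: "\<forall>\<alpha>\<in>P. u \<alpha> \<ge> 0" "sum u P = 1"
      and v: "\<forall>\<alpha>\<in>N-P. v \<alpha> \<ge> 0" "sum v (N - P) = 1"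
      and eq: "(\<lambda>i. \<Sum>\<alpha>\<in>P. u \<alpha> * x \<alpha> i) = (\<lambda>i. \<Sum>\<alpha>\<in>N-P. v \<alpha> * x \<alpha> i)"
      by (elim exE conjE) (rule that; assumption)
    have fin: "finite P" "finite (N - P)" using P less.prems(1) finite_subset by auto
    have "(\<lambda>i. \<Sum>\<alpha>\<in>P. u \<alpha> * x \<alpha> i) \<in> C \<beta>" if \<beta>: "\<beta> \<in> N" for \<beta>
    proof (cases "\<beta> \<in> P")
      case True
      show ?thesis unfolding eq
        by (rule convex_set_sum) (use True P v fin x \<beta> less.prems(4) in auto)
    next
      case False
      show ?thesis
        by (rule convex_set_sum) (use False P u fin x \<beta> less.prems(4) in auto)
    qed
    then show ?thesis by blast
  qed
qed


section \<open>Feasibility sets\<close>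

text \<open>For empty \<open>K\<close> the left-hand side is \<open>O'\<close>, but the intersection is the whole type.\<close>

lemma feasibility_set_union_in:
  "K \<noteq> {} \<Longrightarrow> feasibility_set S J \<epsilon> i' (union_in U K) =
     (\<Inter>\<alpha>\<in>K. feasibility_set S J \<epsilon> i' (patch_in (U \<alpha>)))"
  unfolding feasibility_set_def target_set_def union_in_def by blast

lemma euclid_dist_convex:
  assumes "u \<in> {0..1}"
  shows "euclid_dist d t (\<lambda>i. (1 - u) * x i + u * y i)
           \<le> (1 - u) * euclid_dist d t x + u * euclid_dist d t y"
proof -
  have "euclid_dist d t (\<lambda>i. (1 - u) * x i + u * y i) =
      L2_set (\<lambda>i. (1 - u) * (t i - x i) + u * (t i - y i)) {..<d}"
    unfolding euclid_dist_def by (intro L2_set_cong refl) (simp add: algebra_simps)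
  also have "\<dots> \<le> L2_set (\<lambda>i. (1 - u) * (t i - x i)) {..<d} + L2_set (\<lambda>i. u * (t i - y i)) {..<d}"
    by (rule L2_set_triangle_ineq)
  also have "\<dots> = (1 - u) * euclid_dist d t x + u * euclid_dist d t y"
    using assms by (simp add: euclid_dist_def L2_set_right_distrib)
  finally show ?thesis .
qed

lemma convex_feasibility_set:
  assumes J: "Metric_space (jout_space J) (jout_dist J)" "euclidean_judge d J"
    and C: "convex_set (jout_space J)"
  shows "convex_set (feasibility_set S J \<epsilon> i' X)"
proof -
  interpret Metric_space "jout_space J" "jout_dist J" by (rule J)
  have ball: "(\<lambda>i. (1 - u) * x i + u * y i) \<in> mcball t \<epsilon>"
    if "x \<in> mcball t \<epsilon>" "y \<in> mcball t \<epsilon>" and u: "u \<in> {0..1::real}" for t x y u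
  proof -
    have *: "t \<in> jout_space J" "x \<in> jout_space J" "y \<in> jout_space J"
      "euclid_dist d t x \<le> \<epsilon>" "euclid_dist d t y \<le> \<epsilon>"
      using that J(2) by (auto simp: euclidean_judge_def)
    have z: "(\<lambda>i. (1 - u) * x i + u * y i) \<in> jout_space J"
      using C * u by (simp add: convex_set_def)
    have "(1 - u) * euclid_dist d t x + u * euclid_dist d t y \<le> (1 - u) * \<epsilon> + u * \<epsilon>"
      using * u by (intro add_mono mult_left_mono) auto
    then have "euclid_dist d t (\<lambda>i. (1 - u) * x i + u * y i) \<le> \<epsilon>"
      using euclid_dist_convex[OF u, of d t x y] by (simp add: algebra_simps)
    then show ?thesis using * z J(2) by (simp add: euclidean_judge_def)
  qed
  show ?thesis
    unfolding convex_set_def feasibility_set_def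
    using C ball by (auto simp: convex_set_def simp del: in_mcball)
qed

lemma feasibility_Helly:
  assumes "o_minimal_structure Df" "judge_of Df S J" "euclidean_judge d J"
    and C: "convex_set (jout_space J)" and n: "n \<ge> d + 1"
    and K: "\<And>K. K \<subseteq> {..<n} \<Longrightarrow> card K = d + 1 \<Longrightarrow> feasibility_set S J \<epsilon> i' (union_in U K) \<noteq> {}"
  shows "feasibility_set S J \<epsilon> i' (union_in U {..<n}) \<noteq> {}"
proof -
  interpret o_minimal_structure Df by fact
  have M: "Metric_space (jout_space J) (jout_dist J)" and "jout_space J \<in> Df d"
    using assms(2,3) by (auto simp: judge_of_def definable_map_def euclidean_judge_def)
  then have sub: "feasibility_set S J \<epsilon> i' X \<subseteq> Rn d" for X
    using subset unfolding feasibility_set_def by blast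
  have "(\<Inter>\<alpha>\<in>{..<n}. feasibility_set S J \<epsilon> i' (patch_in (U \<alpha>))) \<noteq> {}"
  proof (rule Helly[where d = d])
    show "(\<Inter>\<alpha>\<in>K. feasibility_set S J \<epsilon> i' (patch_in (U \<alpha>))) \<noteq> {}"
      if "K \<subseteq> {..<n}" "card K = d + 1" for K
      using assms(6)[OF that] that feasibility_set_union_in[of K S J \<epsilon> i' U] by fastforce
  qed (use n sub convex_feasibility_set[OF M assms(3) C] in auto)
  moreover have "{..<n} \<noteq> {}" using n by (metis Suc_eq_plus1 Suc_le_lessD lessThan_iff emptyE)
  ultimately show ?thesis by (simp add: feasibility_set_union_in)
qed


section \<open>Finite sets in an o-minimal structure\<close>

\<comment> \<open>From here on, \<open>truncate\<close> is to mean the truncation of points; the record package declares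
  an operation of the same name for each of the three record types.\<close>
hide_const (open) system.truncate judge.truncate patch.truncate
hide_fact (open) system.truncate_def judge.truncate_def patch.truncate_def

context o_minimal_structure
begin

lemma Rn_definable: "Rn n \<in> Df n"
  using compl[OF empty[of n]] by simp

lemma inter_definable:
  assumes "A \<in> Df n" "B \<in> Df n"
  shows "A \<inter> B \<in> Df n"
proof -
  have "A \<inter> B = Rn n - ((Rn n - A) \<union> (Rn n - B))"
    using subset[OF assms(1)] by blast
  then show ?thesis using assms by (metis compl union)
qed

lemma first_coordinate_definable: "{x \<in> Rn (Suc n). x 0 = c} \<in> Df (Suc n)"
proof (induction n)
  case 0
  have "{x \<in> Rn 1. x 0 = c} \<in> Df 1"
    unfolding o_minimal by (intro exI[of _ "{{c}}"]) (auto simp: is_interval_1)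
  then show ?case by simp
next
  case (Suc n)
  have "{x \<in> Rn (Suc (Suc n)). truncate (Suc n) x \<in> {x \<in> Rn (Suc n). x 0 = c}} =
      {x \<in> Rn (Suc (Suc n)). x 0 = c}"
    by (auto simp: truncate_def topspace_Euclidean_space)
  then show ?case using prod_right[OF Suc] by simp
qed

text \<open>A point of \<open>\<real>\<^sup>n\<^sup>+\<^sup>1\<close> is cut out by its first coordinate and its last \<open>n\<close> coordinates.\<close>

lemma singleton_definable: "p \<in> Rn n \<Longrightarrow> {p} \<in> Df n"
proof (induction n arbitrary: p)
  case 0
  then have "{p} = Rn 0" by (auto simp: topspace_Euclidean_space)
  then show ?case using Rn_definable[of 0] by simp
next
  case (Suc n)
  have "(\<lambda>i. p (Suc i)) \<in> Rn n"
    using Suc.prems by (auto simp: topspace_Euclidean_space)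
  then have "{x \<in> Rn (Suc n). (\<lambda>i. x (Suc i)) \<in> {\<lambda>i. p (Suc i)}} \<in> Df (Suc n)"
    by (intro prod_left Suc.IH)
  moreover have "{p} = {x \<in> Rn (Suc n). (\<lambda>i. x (Suc i)) \<in> {\<lambda>i. p (Suc i)}}
      \<inter> {x \<in> Rn (Suc n). x 0 = p 0}"
  proof -
    have "x = p" if "(\<lambda>i. x (Suc i)) = (\<lambda>i. p (Suc i))" "x 0 = p 0" for x
    proof
      fix i show "x i = p i"
        using that by (cases i) (auto dest: fun_cong)
    qed
    then show ?thesis using Suc.prems by auto
  qed
  ultimately show ?case using inter_definable[OF _ first_coordinate_definable] by simp
qed

lemma finite_definable: "finite A \<Longrightarrow> A \<subseteq> Rn n \<Longrightarrow> A \<in> Df n"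
proof (induction A rule: finite_induct)
  case empty
  show ?case using compl[OF Rn_definable[of n]] by simp
next
  case (insert p A)
  then show ?case using union[OF singleton_definable[of p n], of A] by simp
qed

lemma definable_map_finite:
  assumes "finite A" "A \<subseteq> Rn m" "B \<in> Df n" "f ` A \<subseteq> B"
  shows "definable_map Df m A n B f"
proof -
  have "join m x (f x) \<in> Rn (m + n)" if "x \<in> A" for x
  proof -
    have "f x \<in> Rn n" using that assms subset by blast
    then show ?thesis by (auto simp: join_def topspace_Euclidean_space)
  qed
  then have "(\<lambda>x. join m x (f x)) ` A \<in> Df (m + n)"
    using assms(1) by (intro finite_definable) auto
  then show ?thesis using assms finite_definable by (simp add: definable_map_def)
qed

end

lemma openin_finite_Euclidean:
  assumes "finite A" "A \<subseteq> Rn n" "X \<subseteq> A"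
  shows "openin (subtopology (Euclidean_space n) A) X"
proof -
  have "closedin (Euclidean_space n) (A - X)"
    using assms by (simp add: closedin_Euclidean_space_iff finite_imp_closed) blast
  then have "openin (Euclidean_space n) (Rn n - (A - X))" by blast
  moreover have "X = (Rn n - (A - X)) \<inter> A" using assms by blast
  ultimately show ?thesis unfolding openin_subtopology by blast
qed

lemma Metric_space_euclid_dist: "Metric_space (Rn d) (euclid_dist d)"
proof
  show "euclid_dist d x y = euclid_dist d y x" for x y
    by (simp add: euclid_dist_def L2_set_def power2_commute)
  show "euclid_dist d x y = 0 \<longleftrightarrow> x = y" if "x \<in> Rn d" "y \<in> Rn d" for x y
    using that by (auto simp: euclid_dist_def L2_set_eq_0_iff topspace_Euclidean_space fun_eq_iff)
      (metis lessThan_iff not_less)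
  show "euclid_dist d x z \<le> euclid_dist d x y + euclid_dist d y z" for x y z
    using L2_set_triangle_ineq[of "\<lambda>i. x i - y i" "\<lambda>i. y i - z i" "{..<d}"]
    by (simp add: euclid_dist_def)
qed (simp add: euclid_dist_def)


section \<open>The regular simplex\<close>

text \<open>
  The vertices of a regular simplex in \<^term>\<open>Rn d\<close> with centre \<open>0\<close>: the standard basis vectors,
  translated along the diagonal, and a last vertex on the negative diagonal. The constants \<open>a\<close> and
  \<open>(1 - a) / d\<close> are determined by the centre and by the requirement that the edges at the last
  vertex have the same length \<open>sqrt 2\<close> as those between basis vectors.
\<close>

definition simplex_vertex :: "nat \<Rightarrow> nat \<Rightarrow> point" where
  "simplex_vertex d k = (let a = 1 / sqrt (real d + 1) in
     (\<lambda>i. if i < d then if k < d then (if i = k then 1 else 0) - (1 - a) / real d else - a else 0))"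

lemma simplex_vertex_in_Rn: "simplex_vertex d k \<in> Rn d"
  by (simp add: simplex_vertex_def Let_def topspace_Euclidean_space)

lemma sum_simplex_vertex: "(\<Sum>k\<le>d. simplex_vertex d k i) = 0"
proof (cases "i < d")
  case True
  define a where "a = 1 / sqrt (real d + 1)"
  have "(\<Sum>k\<le>d. simplex_vertex d k i) = (\<Sum>k<d. (if i = k then 1 else 0) - (1 - a) / real d) - a"
    using True by (simp add: simplex_vertex_def Let_def a_def flip: lessThan_Suc_atMost)
  also have "\<dots> = 0"
    using True by (simp add: sum_subtractf)
  finally show ?thesis .
qed (simp add: simplex_vertex_def Let_def)

text \<open>
  This is the Gram matrix of the projections of the standard basis of \<open>\<real>\<^sup>d\<^sup>+\<^sup>1\<close> along
  the diagonal; so the vertices form an isometric copy of the standard simplex centred at \<open>0\<close>. All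
  further geometry uses only these inner products and the vanishing sum of the vertices.
\<close>

lemma simplex_vertex_inner:
  assumes "d \<ge> 1" "j \<le> d" "k \<le> d"
  shows "(\<Sum>i<d. simplex_vertex d j i * simplex_vertex d k i) =
    (if j = k then 1 else 0) - 1 / (real d + 1)"
proof -
  define a where "a = 1 / sqrt (real d + 1)"
  define b where "b = (1 - a) / real d"
  have a2: "a * a = 1 / (real d + 1)" by (simp add: a_def)
  have db: "real d * b = 1 - a" using assms by (simp add: b_def)
  have q: "simplex_vertex d k i = (if k < d then (if i = k then 1 else 0) - b else - a)"
    if "i < d" for i k
    using that by (simp add: simplex_vertex_def Let_def a_def b_def)
  have dbb: "real d * (b * b) = (1 - a) * b" using db by (metis mult.assoc)
  have dab: "real d * (a * b) = a - a * a" using db by (simp add: mult.left_commute right_diff_distrib)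
  have one: "2 * b - (1 - a) * b = 1 / (real d + 1)"
  proof -
    have "real d * (2 * b - (1 - a) * b) = (real d * b) * (1 + a)"
      by (simp add: algebra_simps)
    also have "\<dots> = (1 - a) * (1 + a)" by (simp only: db)
    also have "\<dots> = 1 - 1 / (real d + 1)" using a2 by (simp add: algebra_simps)
    also have "\<dots> = real d * (1 / (real d + 1))" by (simp add: field_simps)
    finally show ?thesis using assms by (subst (asm) mult_cancel_left) simp
  qed
  consider "j < d" "k < d" | "j < d" "k = d" | "j = d" "k < d" | "j = d" "k = d"
    using assms by linarith
  then show ?thesis
  proof cases
    case 1
    have "(\<Sum>i<d. simplex_vertex d j i * simplex_vertex d k i) =
      (\<Sum>i<d. (if i = j then (if j = k then 1 else 0) - b else 0) + (if i = k then - b else 0) + b * b)"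
      using 1 by (intro sum.cong refl) (auto simp: q algebra_simps)
    also have "\<dots> = (if j = k then 1 else 0) - (2 * b - (1 - a) * b)"
      using 1 by (simp add: sum.distrib dbb)
    finally show ?thesis by (simp only: one)
  next
    case 2
    have "(\<Sum>i<d. simplex_vertex d j i * simplex_vertex d k i) =
      (\<Sum>i<d. (if i = j then - a else 0) + a * b)"
      using 2 by (intro sum.cong refl) (auto simp: q algebra_simps)
    also have "\<dots> = - (a * a)"
      using 2 by (simp add: sum.distrib dab)
    finally show ?thesis using 2 a2 by simp
  next
    case 3
    have "(\<Sum>i<d. simplex_vertex d j i * simplex_vertex d k i) =
      (\<Sum>i<d. (if i = k then - a else 0) + a * b)"
      using 3 by (intro sum.cong refl) (auto simp: q algebra_simps)
    also have "\<dots> = - (a * a)"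
      using 3 by (simp add: sum.distrib dab)
    finally show ?thesis using 3 a2 by simp
  next
    case 4
    then have "(\<Sum>i<d. simplex_vertex d j i * simplex_vertex d k i) = real d * (a * a)"
      by (simp add: q)
    then show ?thesis using 4 a2 by (simp add: field_simps)
  qed
qed

text \<open>The point \<open>- q\<^sub>k / d\<close> is the centroid of the facet opposite to the vertex \<open>q\<^sub>k\<close>.\<close>

lemma facet_centre_dist:
  assumes "d \<ge> 1" "j \<le> d" "k \<le> d" "j \<noteq> k"
  shows "euclid_dist d (simplex_vertex d j) (\<lambda>i. - simplex_vertex d k i / real d) = sqrt (1 - 1 / real d)"
proof -
  let ?q = "simplex_vertex d"
  have lin: "(\<Sum>i<d. f i + s * g i + t * h i) = (\<Sum>i<d. f i) + s * (\<Sum>i<d. g i) + t * (\<Sum>i<d. h i)"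
    for s t :: real and f g h by (simp add: sum.distrib sum_distrib_left)
  have "(\<Sum>i<d. (?q j i - - ?q k i / real d)\<^sup>2) =
      (\<Sum>i<d. ?q j i * ?q j i + 2 / real d * (?q j i * ?q k i) + 1 / (real d)\<^sup>2 * (?q k i * ?q k i))"
    by (intro sum.cong refl) (simp add: power2_eq_square field_simps)
  also have "\<dots> = (1 - 1 / (real d + 1)) - 2 / real d * (1 / (real d + 1))
      + 1 / (real d)\<^sup>2 * (1 - 1 / (real d + 1))"
    unfolding lin using assms by (simp add: simplex_vertex_inner)
  also have "\<dots> = 1 - 1 / real d"
    using assms by (simp add: divide_simps) (simp add: algebra_simps power2_eq_square)
  finally show ?thesis by (simp add: euclid_dist_def L2_set_def)
qed

text \<open>
  As the vertices sum to \<open>0\<close>, the mixed terms cancel when the squared distances from \<open>x\<close> to the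
  \<open>d + 1\<close> vertices are added up: the sum is at least that of the squared norms of the vertices, which
  is \<open>d\<close>. If each squared distance were at most \<open>1 - 1 / d\<close>, it would be at most \<open>d - 1 / d\<close>.
\<close>

lemma simplex_uncoverable:
  assumes "d \<ge> 1"
  shows "\<exists>k\<le>d. euclid_dist d (simplex_vertex d k) x > sqrt (1 - 1 / real d)"
proof (rule ccontr)
  let ?q = "simplex_vertex d"
  assume "\<not> ?thesis"
  then have "(\<Sum>i<d. (?q k i - x i)\<^sup>2) \<le> 1 - 1 / real d" if "k \<le> d" for k
    using that by (auto simp: euclid_dist_def L2_set_def not_less)
  then have "(\<Sum>k\<le>d. \<Sum>i<d. (?q k i - x i)\<^sup>2) \<le> (\<Sum>k\<le>d. 1 - 1 / real d)"
    by (intro sum_mono) auto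
  also have "\<dots> < real d"
    using assms by (simp add: field_simps)
  finally have upper: "(\<Sum>k\<le>d. \<Sum>i<d. (?q k i - x i)\<^sup>2) < real d" .
  have "(\<Sum>i<d. (?q k i - x i)\<^sup>2) \<ge> (1 - 1 / (real d + 1)) - 2 * (\<Sum>i<d. x i * ?q k i)"
    if "k \<le> d" for k
  proof -
    have "(1 - 1 / (real d + 1)) - 2 * (\<Sum>i<d. x i * ?q k i) =
        (\<Sum>i<d. ?q k i * ?q k i - 2 * (x i * ?q k i))"
      using assms that by (simp add: sum_subtractf simplex_vertex_inner sum_distrib_left)
    also have "\<dots> \<le> (\<Sum>i<d. (?q k i - x i)\<^sup>2)"
      by (intro sum_mono) (simp add: power2_eq_square algebra_simps)
    finally show ?thesis .
  qed
  then have "(\<Sum>k\<le>d. (1 - 1 / (real d + 1)) - 2 * (\<Sum>i<d. x i * ?q k i))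
      \<le> (\<Sum>k\<le>d. \<Sum>i<d. (?q k i - x i)\<^sup>2)"
    by (intro sum_mono) auto
  moreover have "(\<Sum>k\<le>d. \<Sum>i<d. x i * ?q k i) = 0"
    by (subst sum.swap) (simp add: sum_simplex_vertex flip: sum_distrib_left)
  then have "(\<Sum>k\<le>d. 2 * (\<Sum>i<d. x i * ?q k i)) = 0"
    by (simp flip: sum_distrib_left)
  then have "(\<Sum>k\<le>d. (1 - 1 / (real d + 1)) - 2 * (\<Sum>i<d. x i * ?q k i)) =
      (real d + 1) * (1 - 1 / (real d + 1))"
    by (simp only: sum_subtractf) (simp add: algebra_simps)
  moreover have "(real d + 1) * (1 - 1 / (real d + 1)) = real d"
    by (simp add: field_simps)
  ultimately show False using upper by simp
qed


section \<open>Sharpness of the bound\<close>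

definition simplex_system :: "nat \<Rightarrow> system" where
  "simplex_system d =
     \<lparr>in_dim = d, inputs = simplex_vertex d ` {..d}, out_dim = d, outputs = simplex_vertex d ` {..d},
      out_fun = id\<rparr>"

text \<open>The input labels live in \<open>\<real>\<^sup>0\<close>, so that all inputs share the label \<open>0\<close>.\<close>

definition simplex_judge :: "nat \<Rightarrow> judge" where
  "simplex_judge d =
     \<lparr>jin_dim = 0, jin_space = Rn 0, jin_map = (\<lambda>_ _. 0), jout_dim = d, jout_space = Rn d,
      jout_map = id, jout_dist = euclid_dist d\<rparr>"

definition simplex_patch :: "nat \<Rightarrow> nat \<Rightarrow> patch" where
  "simplex_patch d k = \<lparr>patch_in = {simplex_vertex d k}, patch_out = {simplex_vertex d k}\<rparr>"

lemma simplex_feasibility: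
  "x \<in> feasibility_set (simplex_system d) (simplex_judge d) \<epsilon> (\<lambda>_. 0) (union_in (simplex_patch d) K)
   \<longleftrightarrow> x \<in> Rn d \<and> (\<forall>k\<in>K. euclid_dist d (simplex_vertex d k) x \<le> \<epsilon>)"
proof -
  interpret Metric_space "Rn d" "euclid_dist d" by (rule Metric_space_euclid_dist)
  have "target_set (simplex_system d) (simplex_judge d) (\<lambda>_. 0) (union_in (simplex_patch d) K)
      = simplex_vertex d ` K"
    by (auto simp: target_set_def union_in_def simplex_system_def simplex_judge_def simplex_patch_def)
  then show ?thesis
    using simplex_vertex_in_Rn[of d]
    by (auto simp: feasibility_set_def simplex_judge_def)
qed

lemma (in o_minimal_structure) simplex_system_covered:
  shows "stateless_system Df (simplex_system d)"
    and "judge_of Df (simplex_system d) (simplex_judge d)"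
    and "covering Df (simplex_system d) (d + 1) (simplex_patch d)"
proof -
  let ?V = "simplex_vertex d ` {..d}"
  have V: "finite ?V" "?V \<subseteq> Rn d" using simplex_vertex_in_Rn by auto
  have zero: "(\<lambda>_. 0) \<in> Rn 0" by (simp add: topspace_Euclidean_space)
  show "stateless_system Df (simplex_system d)"
    using V by (simp add: stateless_system_def simplex_system_def definable_map_finite finite_definable)
  have "definable_map Df d ?V 0 (Rn 0) (\<lambda>_ _. 0)"
    using V zero Rn_definable[of 0] by (intro definable_map_finite) auto
  moreover have "definable_map Df d ?V d (Rn d) id"
    using V Rn_definable[of d] by (intro definable_map_finite) auto
  ultimately show "judge_of Df (simplex_system d) (simplex_judge d)"
    using Metric_space_euclid_dist
    by (simp add: judge_of_def simplex_system_def simplex_judge_def)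
  have "patch_of Df (simplex_system d) (simplex_patch d k)" if "k \<le> d" for k
    using that V simplex_vertex_in_Rn[of d k] openin_finite_Euclidean[OF V, of "{simplex_vertex d k}"]
    by (simp add: patch_of_def simplex_system_def simplex_patch_def singleton_definable)
  then show "covering Df (simplex_system d) (d + 1) (simplex_patch d)"
    by (auto simp: covering_def simplex_system_def simplex_patch_def less_Suc_eq_le)
qed

lemma simplex_facets_feasible:
  assumes "d \<ge> 1" "K \<subseteq> {..<d + 1}" "card K = d"
  shows "feasibility_set (simplex_system d) (simplex_judge d) (sqrt (1 - 1 / real d)) (\<lambda>_. 0)
           (union_in (simplex_patch d) K) \<noteq> {}"
proof -
  have "finite K" using assms(2) finite_subset by blast
  then have "\<not> {..<d + 1} \<subseteq> K" using assms(3) card_mono[of K "{..<d + 1}"] by auto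
  then obtain k where "k \<in> {..<d + 1}" "k \<notin> K" by blast
  then have k: "k \<le> d" "k \<notin> K" by auto
  let ?c = "\<lambda>i. - simplex_vertex d k i / real d"
  have "?c \<in> Rn d"
    using simplex_vertex_in_Rn[of d k] by (simp add: topspace_Euclidean_space)
  moreover have "euclid_dist d (simplex_vertex d j) ?c \<le> sqrt (1 - 1 / real d)" if "j \<in> K" for j
  proof -
    have "j \<le> d" "j \<noteq> k" using that k assms(2) by auto
    then show ?thesis using facet_centre_dist[OF assms(1), of j k] k by simp
  qed
  ultimately have "?c \<in> feasibility_set (simplex_system d) (simplex_judge d)
      (sqrt (1 - 1 / real d)) (\<lambda>_. 0) (union_in (simplex_patch d) K)"
    unfolding simplex_feasibility by blast
  then show ?thesis by blast
qed

theorem theorem6p3: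
  fixes Df :: "nat \<Rightarrow> point set set"
  assumes "o_minimal_structure Df"
  shows
    "(\<forall>(d::nat) (S::system) (J::judge) (\<epsilon>::real) (n::nat) (U::nat \<Rightarrow> patch) (i'::point).
        stateless_system Df S \<longrightarrow> judge_of Df S J \<longrightarrow>
        euclidean_judge d J \<longrightarrow> convex_set (jout_space J) \<longrightarrow> \<epsilon> \<ge> 0 \<longrightarrow>
        covering Df S n U \<longrightarrow> n \<ge> d + 1 \<longrightarrow> i' \<in> jin_space J \<longrightarrow>
        (\<forall>K. K \<subseteq> {..<n} \<and> card K = d + 1 \<longrightarrow>
           feasibility_set S J \<epsilon> i' (union_in U K) \<noteq> {}) \<longrightarrow>
        feasibility_set S J \<epsilon> i' (union_in U {..<n}) \<noteq> {})
     \<and>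
     (\<forall>d::nat. d \<ge> 1 \<longrightarrow>
        (\<exists>(S::system) (J::judge) (\<epsilon>::real) (n::nat) (U::nat \<Rightarrow> patch) (i'::point).
           stateless_system Df S \<and> judge_of Df S J \<and>
           euclidean_judge d J \<and> jout_space J = Rn d \<and> \<epsilon> \<ge> 0 \<and>
           covering Df S n U \<and> n \<ge> d + 1 \<and> i' \<in> jin_space J \<and>
           (\<forall>K. K \<subseteq> {..<n} \<and> card K = d \<longrightarrow>
              feasibility_set S J \<epsilon> i' (union_in U K) \<noteq> {}) \<and>
           feasibility_set S J \<epsilon> i' (union_in U {..<n}) = {}))"
proof (intro conjI allI impI, goal_cases)
  case (1 d S J \<epsilon> n U i')
  then show ?case
    using feasibility_Helly[OF assms, of S J d n \<epsilon> i' U] by simp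
next
  case (2 d)
  interpret o_minimal_structure Df by (rule assms)
  let ?S = "simplex_system d" and ?J = "simplex_judge d" and ?\<epsilon> = "sqrt (1 - 1 / real d)"
  show ?case
  proof (intro exI conjI)
    show "stateless_system Df ?S" "judge_of Df ?S ?J" "covering Df ?S (d + 1) (simplex_patch d)"
      by (rule simplex_system_covered)+
    show "euclidean_judge d ?J" "jout_space ?J = Rn d" "(\<lambda>_. 0) \<in> jin_space ?J"
      by (simp_all add: euclidean_judge_def simplex_judge_def topspace_Euclidean_space)
    show "?\<epsilon> \<ge> 0" using 2 by simp
    show "\<forall>K. K \<subseteq> {..<d + 1} \<and> card K = d \<longrightarrow>
        feasibility_set ?S ?J ?\<epsilon> (\<lambda>_. 0) (union_in (simplex_patch d) K) \<noteq> {}"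
      using simplex_facets_feasible[OF 2] by blast
    show "feasibility_set ?S ?J ?\<epsilon> (\<lambda>_. 0) (union_in (simplex_patch d) {..<d + 1}) = {}"
      using simplex_uncoverable[OF 2]
      by (force simp: simplex_feasibility less_Suc_eq_le not_le set_eq_iff)
  qed simp
qed

end
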